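(* Let $G$ be a graph with $n\ge4$ vertices and $M=M[IAS(G)]$. Then the following are equivalent. \begin{enumerate} \item Some graph locally equivalent to $G$ has a vertex of degree $<\frac{n-1}{2}$. \item $M$ has a transverse circuit of size $<\frac{n+1}{2}$. \item There is a subset $X\subseteq V(G)$ such that $\tau_G(X)$ and $\tau_G(V(G)-X)$ both contain transverse circuits. \item $\kappa(M)<n$. \end{enumerate}
   Context: A graph is a finite looped simple graph; neighbors via non-loop edges, $N_G(v)=\{w\neq v\mid vw\in E(G)\}$, degree of $v$ is $|N_G(v)|$. $A(G)$ is the $GF(2)$ adjacency matrix (diagonal 1 iff looped). $M[IAS(G)]$ is the binary matroid represented by $(I\;A(G)\;A(G)+I)$, with elements $\phi_G(v),\chi_G(v),\psi_G(v)$ (the $v$ columns of $I,A(G),A(G)+I$); $\tau_G(v)=\{\phi_G(v),\chi_G(v),\psi_G(v)\}$, $\tau_G(X)=\bigcup_{x\in X}\tau_G(x)$. A transversal meets every vertex triple exactly once; a transverse circuit is a circuit of $M$ contained in some transversal. For a matroid on $W$ with rank $r$, $\lambda(S)=r(S)+r(W-S)-r(M)$; $S$ is a vertical $k$-separation if $\lambda(S)<k$ and $r(S),r(W-S)\ge k$; $\kappa(M)=\min(\{k\mid\text{vertical }k\text{-separation exists}\}\cup\{r(M)\})$. Local equivalence: loop complement at $v$ reverses the loop status of $v$; simple local complement at $v$ reverses adjacencies between distinct neighbors of $v$; non-simple local complement additionally reverses loop status at all neighbors of $v$; locally equivalent graphs are related by a sequence of these operations. *)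

theory Defs
  imports Complex_Main "HOL-Library.Z2"
begin

section \<open>Looped simple graphs and local equivalence\<close>

text \<open>An edge is the set of its end-vertices, so a loop at \<open>v\<close> is the singleton \<open>{v} = {v, v}\<close>.\<close>

record 'a looped_graph =
  gverts :: "'a set"
  gedges :: "'a set set"

definition looped_simple_graph :: "'a looped_graph \<Rightarrow> bool" where
  "looped_simple_graph G \<longleftrightarrow>
     finite (gverts G) \<and> (\<forall>e\<in>gedges G. \<exists>u\<in>gverts G. \<exists>v\<in>gverts G. e = {u, v})"

definition nbrs :: "'a looped_graph \<Rightarrow> 'a \<Rightarrow> 'a set" where
  "nbrs G v = {w. w \<noteq> v \<and> {v, w} \<in> gedges G}"

definition vdegree :: "'a looped_graph \<Rightarrow> 'a \<Rightarrow> nat" where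
  "vdegree G v = card (nbrs G v)"

definition loop_complement :: "'a looped_graph \<Rightarrow> 'a \<Rightarrow> 'a looped_graph" where
  "loop_complement G v = G\<lparr>gedges := sym_diff (gedges G) {{v}}\<rparr>"

definition simple_local_complement :: "'a looped_graph \<Rightarrow> 'a \<Rightarrow> 'a looped_graph" where
  "simple_local_complement G v =
     G\<lparr>gedges := sym_diff (gedges G) {{x, y} | x y. x \<in> nbrs G v \<and> y \<in> nbrs G v \<and> x \<noteq> y}\<rparr>"

text \<open>Dropping \<open>x \<noteq> y\<close> also reverses the loop status \<open>{x}\<close> of each neighbor \<open>x\<close>.\<close>

definition nonsimple_local_complement :: "'a looped_graph \<Rightarrow> 'a \<Rightarrow> 'a looped_graph" where
  "nonsimple_local_complement G v =
     G\<lparr>gedges := sym_diff (gedges G) {{x, y} | x y. x \<in> nbrs G v \<and> y \<in> nbrs G v}\<rparr>"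

definition local_step :: "'a looped_graph \<Rightarrow> 'a looped_graph \<Rightarrow> bool" where
  "local_step G H \<longleftrightarrow>
     (\<exists>v\<in>gverts G. H = loop_complement G v \<or> H = simple_local_complement G v
        \<or> H = nonsimple_local_complement G v)"

definition locally_equivalent :: "'a looped_graph \<Rightarrow> 'a looped_graph \<Rightarrow> bool" where
  "locally_equivalent = local_step\<^sup>*\<^sup>*"

section \<open>Matroids\<close>

record 'e matroid =
  mground :: "'e set"
  mindep :: "'e set \<Rightarrow> bool"

text \<open>
  The matroid on \<open>W\<close> represented by the matrix with row index set \<open>R\<close> whose column at \<open>e \<in> W\<close> is
  \<open>col e\<close> (restricted to \<open>R\<close>), both finite. Linear independence is that of the
  indexed family of columns, so distinct elements with equal columns are dependent.
\<close>

definition column_matroid :: "'r set \<Rightarrow> 'e set \<Rightarrow> ('e \<Rightarrow> 'r \<Rightarrow> 'f::field) \<Rightarrow> 'e matroid" where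
  "column_matroid R W col =
     \<lparr>mground = W,
      mindep = (\<lambda>S. S \<subseteq> W \<and>
        (\<forall>c. (\<forall>u\<in>R. (\<Sum>e\<in>S. c e * col e u) = 0) \<longrightarrow> (\<forall>e\<in>S. c e = 0)))\<rparr>"

definition mcircuit :: "'e matroid \<Rightarrow> 'e set \<Rightarrow> bool" where
  "mcircuit M C \<longleftrightarrow> C \<subseteq> mground M \<and> \<not> mindep M C \<and> (\<forall>D. D \<subset> C \<longrightarrow> mindep M D)"

definition mrank :: "'e matroid \<Rightarrow> 'e set \<Rightarrow> nat" where
  "mrank M S = Max {card I | I. I \<subseteq> S \<and> mindep M I}"

definition mconn :: "'e matroid \<Rightarrow> 'e set \<Rightarrow> int" where
  "mconn M S = int (mrank M S) + int (mrank M (mground M - S)) - int (mrank M (mground M))"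

definition vertical_separation :: "'e matroid \<Rightarrow> nat \<Rightarrow> 'e set \<Rightarrow> bool" where
  "vertical_separation M k S \<longleftrightarrow>
     S \<subseteq> mground M \<and> mconn M S < int k \<and> mrank M S \<ge> k \<and> mrank M (mground M - S) \<ge> k"

text \<open>The infimum of a nonempty set of natural numbers is its minimum.\<close>

definition vertical_connectivity :: "'e matroid \<Rightarrow> nat" where
  "vertical_connectivity M =
     Inf ({k. \<exists>S. vertical_separation M k S} \<union> {mrank M (mground M)})"

section \<open>The isotropic matroid\<close>

datatype 'a ias_elem = Phi 'a | Chi 'a | Psi 'a

definition adj_matrix :: "'a looped_graph \<Rightarrow> 'a \<Rightarrow> 'a \<Rightarrow> bit" where
  "adj_matrix G u v = of_bool ({u, v} \<in> gedges G)"

fun ias_column :: "'a looped_graph \<Rightarrow> 'a ias_elem \<Rightarrow> 'a \<Rightarrow> bit" where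
  "ias_column G (Phi v) u = of_bool (u = v)"
| "ias_column G (Chi v) u = adj_matrix G u v"
| "ias_column G (Psi v) u = adj_matrix G u v + of_bool (u = v)"

definition vertex_triple :: "'a \<Rightarrow> 'a ias_elem set" where
  "vertex_triple v = {Phi v, Chi v, Psi v}"

definition vertex_triples :: "'a set \<Rightarrow> 'a ias_elem set" where
  "vertex_triples X = (\<Union>x\<in>X. vertex_triple x)"

definition ias_matroid :: "'a looped_graph \<Rightarrow> 'a ias_elem matroid" where
  "ias_matroid G = column_matroid (gverts G) (vertex_triples (gverts G)) (ias_column G)"

definition transversal :: "'a looped_graph \<Rightarrow> 'a ias_elem set \<Rightarrow> bool" where
  "transversal G T \<longleftrightarrow>
     T \<subseteq> vertex_triples (gverts G) \<and> (\<forall>v\<in>gverts G. card (T \<inter> vertex_triple v) = 1)"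

definition transverse_circuit :: "'a looped_graph \<Rightarrow> 'a ias_elem set \<Rightarrow> bool" where
  "transverse_circuit G C \<longleftrightarrow> mcircuit (ias_matroid G) C \<and> (\<exists>T. transversal G T \<and> C \<subseteq> T)"

end

theory Submission
  imports Defs "HOL-Library.FuncSet"
begin

text \<open>
  Let \<open>A = A(G)\<close>, over the field with two elements. Every vector \<open>Y\<close> yields an element \<open>(A Y, Y)\<close> of
  the kernel of \<open>(I A)\<close>, and the inclusion-minimal supports of nonzero kernel elements are the vertex
  sets of the transverse circuits. Hence the second condition says that some \<open>Y \<noteq> 0\<close> has support of
  size at most \<open>n/2\<close>, and the third that two nonzero vectors have disjoint supports, so that the
  third implies the second. Conversely, since \<open>A\<close> is symmetric the kernel is self-orthogonal for the
  symplectic form, and a dimension count yields a nonzero element supported off a given support of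
  size at most \<open>n/2\<close>. Condition four says that the ground set splits into two
  nonspanning sets, each annihilated by a nonzero vector; these two vectors have disjoint supports.
  Local complementation carries the kernel of one graph to that of the other and preserves
  supports, and \<open>{v} \<union> N(v)\<close> is the support of the unit vector at \<open>v\<close>, which gives the first condition.
\<close>

text \<open>These rules turn the field operations of \<open>bit\<close> into bit operations, to which the lemmas on sums
  do not apply.\<close>

declare add_bit_eq_xor [simp del] mult_bit_eq_and [simp del]

section \<open>Parities, non-loop neighborhoods and kernel supports\<close>

text \<open>The intersection is lost twice, an even amount. This is additivity of parity when
  vectors over the two-element field are added as vertex sets.\<close>

lemma odd_card_sym_diff:
  assumes "finite A" "finite B"
  shows "odd (card (sym_diff A B)) \<longleftrightarrow> odd (card A) \<noteq> odd (card B)"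
proof -
  have "card A = card (A - B) + card (A \<inter> B)" "card B = card (B - A) + card (A \<inter> B)"
    using assms card_Diff_subset_Int[of A B] card_Diff_subset_Int[of B A]
      card_mono[of A "A \<inter> B"] card_mono[of B "A \<inter> B"] by (auto simp: Int_commute)
  moreover have "card (sym_diff A B) = card (A - B) + card (B - A)"
    using assms by (intro card_Un_disjoint) auto
  ultimately show ?thesis by auto
qed

lemma nbrs_sym: "u \<in> nbrs G v \<longleftrightarrow> v \<in> nbrs G u"
  by (auto simp: nbrs_def insert_commute)

lemma nbrs_irrefl [simp]: "v \<notin> nbrs G v"
  by (simp add: nbrs_def)

lemma nbrs_subset: "looped_simple_graph G \<Longrightarrow> nbrs G v \<subseteq> gverts G"
  unfolding looped_simple_graph_def nbrs_def by (auto simp: doubleton_eq_iff dest!: bspec)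

lemma finite_nbrs: "looped_simple_graph G \<Longrightarrow> finite (nbrs G v)"
  by (meson finite_subset looped_simple_graph_def nbrs_subset)

text \<open>
  A vector \<open>Y\<close> over the two-element field, given as a vertex set, corresponds to the element
  \<open>(A(G) Y, Y)\<close> of the kernel of \<open>(I A(G))\<close>. Its support consists of the vertices at which one of
  the two components is nonzero; a loop at \<open>v \<in> Y\<close> does not affect this condition, so it may be
  stated in terms of non-loop neighbors.
\<close>

definition kernel_support :: "'a looped_graph \<Rightarrow> 'a set \<Rightarrow> 'a set" where
  "kernel_support G Y = Y \<union> {v \<in> gverts G. odd (card (nbrs G v \<inter> Y))}"

lemma kernel_support_subset: "Y \<subseteq> gverts G \<Longrightarrow> kernel_support G Y \<subseteq> gverts G"
  by (auto simp: kernel_support_def)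

text \<open>The size of this support is the degree of \<open>v\<close> plus one, which turns degree
  bounds into bounds on supports.\<close>

lemma kernel_support_singleton:
  assumes "looped_simple_graph G"
  shows "kernel_support G {v} = insert v (nbrs G v)"
proof -
  have "odd (card (nbrs G u \<inter> {v})) \<longleftrightarrow> u \<in> nbrs G v" for u
    by (cases "v \<in> nbrs G u") (auto simp: nbrs_sym)
  then show ?thesis
    using nbrs_subset[OF assms, of v] by (auto simp: kernel_support_def)
qed

section \<open>Invariance of kernel supports under local equivalence\<close>

lemma local_step_gverts: "local_step G H \<Longrightarrow> gverts H = gverts G"
  unfolding local_step_def loop_complement_def simple_local_complement_def
    nonsimple_local_complement_def
  by (elim bexE disjE) simp_all

lemma locally_equivalent_gverts: "locally_equivalent G H \<Longrightarrow> gverts H = gverts G"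
  unfolding locally_equivalent_def by (induction rule: rtranclp_induct) (simp_all add: local_step_gverts)

lemma nbrs_loop_complement: "nbrs (loop_complement G v) w = nbrs G w"
  by (auto simp: nbrs_def loop_complement_def)

text \<open>The simple and non-simple operations differ only in loops, which \<open>nbrs\<close>
  ignores, so one formula serves both. Subtracting \<open>{w}\<close> keeps \<open>w\<close> out of
  its own neighborhood.\<close>

lemma nbrs_local_complement:
  assumes "H = simple_local_complement G v \<or> H = nonsimple_local_complement G v"
  shows "nbrs H w = (if w \<in> nbrs G v then sym_diff (nbrs G w) (nbrs G v - {w}) else nbrs G w)"
proof -
  let ?N = "nbrs G v"
  have "{w, x} \<in> gedges H \<longleftrightarrow> ({w, x} \<in> gedges G) \<noteq> (w \<in> ?N \<and> x \<in> ?N)"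
    if "x \<noteq> w" for x
  proof -
    let ?D = "{{x, y} | x y. x \<in> ?N \<and> y \<in> ?N \<and> x \<noteq> y}" and ?E = "{{x, y} | x y. x \<in> ?N \<and> y \<in> ?N}"
    have "{w, x} \<in> ?D \<longleftrightarrow> w \<in> ?N \<and> x \<in> ?N" "{w, x} \<in> ?E \<longleftrightarrow> w \<in> ?N \<and> x \<in> ?N"
      using that by (simp_all add: doubleton_eq_iff, blast+)
    moreover have "gedges H = sym_diff (gedges G) ?D \<or> gedges H = sym_diff (gedges G) ?E"
      using assms by (elim disjE) (simp_all add: simple_local_complement_def nonsimple_local_complement_def)
    ultimately show ?thesis by (metis (no_types, lifting) DiffE DiffI UnE UnI1 UnI2)
  qed
  then have mem: "x \<in> nbrs H w \<longleftrightarrow> x \<noteq> w \<and> (x \<in> nbrs G w) \<noteq> (w \<in> ?N \<and> x \<in> ?N)" for x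
    by (auto simp: nbrs_def[of H w] nbrs_def[of G w])
  show ?thesis
  proof (rule set_eqI)
    fix x
    show "x \<in> nbrs H w \<longleftrightarrow>
        x \<in> (if w \<in> ?N then sym_diff (nbrs G w) (?N - {w}) else nbrs G w)"
      unfolding mem
      by (cases "w \<in> ?N"; cases "x = w"; cases "x \<in> ?N"; cases "x \<in> nbrs G w") simp_all
  qed
qed

lemma local_step_looped_simple_graph:
  assumes "local_step G H" "looped_simple_graph G"
  shows "looped_simple_graph H"
proof -
  from assms(1) obtain v where v: "v \<in> gverts G" "gverts H = gverts G" and
    "gedges H = sym_diff (gedges G) {{v}} \<or>
     gedges H = sym_diff (gedges G) {{x, y} | x y. x \<in> nbrs G v \<and> y \<in> nbrs G v \<and> x \<noteq> y} \<or>
     gedges H = sym_diff (gedges G) {{x, y} | x y. x \<in> nbrs G v \<and> y \<in> nbrs G v}"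
    by (auto simp: local_step_def loop_complement_def simple_local_complement_def
      nonsimple_local_complement_def)
  then have "e \<in> gedges G \<or> e = {v, v} \<or> (\<exists>x\<in>nbrs G v. \<exists>y\<in>nbrs G v. e = {x, y})"
    if "e \<in> gedges H" for e
    using that by (elim disjE) (simp_all, blast+)
  then have "\<exists>x\<in>gverts G. \<exists>y\<in>gverts G. e = {x, y}" if "e \<in> gedges H" for e
    using that assms(2) v(1) subsetD[OF nbrs_subset[OF assms(2)]]
    unfolding looped_simple_graph_def by metis
  then show ?thesis using assms(2) v(2) by (simp add: looped_simple_graph_def)
qed

lemma locally_equivalent_looped_simple_graph:
  "locally_equivalent G H \<Longrightarrow> looped_simple_graph G \<Longrightarrow> looped_simple_graph H"
  unfolding locally_equivalent_def
  by (induction rule: rtranclp_induct) (auto intro: local_step_looped_simple_graph)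

text \<open>The vector of the local complement at \<open>v\<close> that has the same support as
  \<open>Y\<close>: the parity of the neighbors of \<open>v\<close> in \<open>Y\<close> is added to
  coordinate \<open>v\<close>.\<close>

definition lc_vector :: "'a looped_graph \<Rightarrow> 'a \<Rightarrow> 'a set \<Rightarrow> 'a set" where
  "lc_vector G v Y = (if odd (card (nbrs G v \<inter> Y)) then sym_diff Y {v} else Y)"

text \<open>Record at each vertex the pair of its coordinate and the parity of its neighbors in the
  vector. At a neighbor of \<open>v\<close> the pair (a, p) becomes (a, p + a), at \<open>v\<close>
  itself (a, s) becomes (a + s, s), and elsewhere nothing changes. These maps are linear and
  invertible, so nonzero pairs stay nonzero.\<close>

lemma kernel_support_local_complement:
  assumes G: "looped_simple_graph G"
    and H: "H = simple_local_complement G v \<or> H = nonsimple_local_complement G v"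
    and v: "v \<in> gverts G"
  shows "kernel_support H (lc_vector G v Y) = kernel_support G Y"
proof -
  define s where "s \<longleftrightarrow> odd (card (nbrs G v \<inter> Y))"
  define Y' where "Y' = lc_vector G v Y"
  note fin = finite_nbrs[OF G]
  have gv: "gverts H = gverts G"
    using H by (auto simp: simple_local_complement_def nonsimple_local_complement_def)
  have Y': "w \<in> Y' \<longleftrightarrow> (w \<in> Y) \<noteq> (s \<and> w = v)" for w
    by (auto simp: Y'_def lc_vector_def s_def)
  have nv: "nbrs G v \<inter> Y' = nbrs G v \<inter> Y"
    using Y' by (auto simp: nbrs_def)
  have "w \<in> Y' \<or> odd (card (nbrs H w \<inter> Y')) \<longleftrightarrow> w \<in> Y \<or> odd (card (nbrs G w \<inter> Y))" for w
  proof (cases "w \<in> nbrs G v")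
    case True
    then have wv: "w \<noteq> v" "v \<in> nbrs G w" by (auto simp: nbrs_sym)
    have "nbrs H w \<inter> Y' = sym_diff (nbrs G w \<inter> Y') ((nbrs G v \<inter> Y) - {w})"
      using nbrs_local_complement[OF H, of w] True nv by auto
    then have "odd (card (nbrs H w \<inter> Y')) \<longleftrightarrow>
        odd (card (nbrs G w \<inter> Y')) \<noteq> odd (card ((nbrs G v \<inter> Y) - {w}))"
      using odd_card_sym_diff fin by (metis finite_Diff finite_Int)
    moreover have "odd (card ((nbrs G v \<inter> Y) - {w})) \<longleftrightarrow> s \<noteq> (w \<in> Y)"
    proof (cases "w \<in> Y")
      case True
      then have "card (nbrs G v \<inter> Y) = Suc (card ((nbrs G v \<inter> Y) - {w}))"
        using \<open>w \<in> nbrs G v\<close> fin by (intro card.remove) auto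
      then show ?thesis using True by (simp add: s_def)
    qed (simp add: s_def)
    moreover have "odd (card (nbrs G w \<inter> Y')) \<longleftrightarrow> odd (card (nbrs G w \<inter> Y)) \<noteq> s"
    proof (cases s)
      case True
      then have "nbrs G w \<inter> Y' = sym_diff (nbrs G w \<inter> Y) {v}"
        using Y' wv by auto
      then show ?thesis
        using True odd_card_sym_diff[of "nbrs G w \<inter> Y" "{v}"] fin by auto
    next
      case False
      then have "Y' = Y" using Y' by auto
      then show ?thesis using False by simp
    qed
    ultimately show ?thesis using Y' wv by auto
  next
    case False
    then have "nbrs H w = nbrs G w" using nbrs_local_complement[OF H, of w] by simp
    moreover have "nbrs G w \<inter> Y' = nbrs G w \<inter> Y"
      using False Y' by (auto simp: nbrs_sym)
    ultimately show ?thesis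
      using Y'[of w] by (cases "w = v") (auto simp: s_def)
  qed
  then show ?thesis
    using gv v Y' unfolding kernel_support_def Y'_def by fastforce
qed

lemma lc_vector_subset: "v \<in> gverts G \<Longrightarrow> Y \<subseteq> gverts G \<Longrightarrow> lc_vector G v Y \<subseteq> gverts G"
  by (auto simp: lc_vector_def)

lemma kernel_support_empty_iff: "kernel_support G Y = {} \<longleftrightarrow> Y = {}"
  by (auto simp: kernel_support_def)

lemma local_step_kernel_support:
  assumes G: "looped_simple_graph G" and step: "local_step G H"
    and Y: "Y \<subseteq> gverts G"
  obtains Z where "Z \<subseteq> gverts G" "kernel_support G Z = kernel_support H Y"
proof -
  from step consider v where "v \<in> gverts G" "H = loop_complement G v"
    | v where "v \<in> gverts G" "H = simple_local_complement G v \<or> H = nonsimple_local_complement G v"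
    by (auto simp: local_step_def)
  then show thesis
  proof cases
    case 1
    then have "kernel_support G Y = kernel_support H Y"
      by (simp add: kernel_support_def nbrs_loop_complement) (simp add: loop_complement_def)
    with Y that show thesis by blast
  next
    case 2
    define Z where "Z = lc_vector G v Y"
    \<comment> \<open>\<open>lc_vector\<close> is an involution: it changes only coordinate
      \<open>v\<close>, and \<open>v\<close> is not its own neighbor. Hence supports can be pulled
      back from \<open>H\<close> to \<open>G\<close>.\<close>
    have "lc_vector G v Z = Y"
    proof -
      have "nbrs G v \<inter> Z = nbrs G v \<inter> Y"
        by (auto simp: Z_def lc_vector_def nbrs_def)
      then show ?thesis by (auto simp: Z_def lc_vector_def)
    qed
    then have "kernel_support G Z = kernel_support H Y"
      using kernel_support_local_complement[OF G 2(2,1), of Z] by simp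
    moreover have "Z \<subseteq> gverts G" using lc_vector_subset[OF 2(1) Y] by (simp add: Z_def)
    ultimately show thesis using that by blast
  qed
qed

lemma locally_equivalent_kernel_support:
  assumes "locally_equivalent G H" "looped_simple_graph G" "Y \<subseteq> gverts G"
  shows "\<exists>Z \<subseteq> gverts G. kernel_support G Z = kernel_support H Y"
proof -
  have "local_step\<^sup>*\<^sup>* G H" using assms(1) by (simp add: locally_equivalent_def)
  then show ?thesis using assms(2,3)
  proof (induction arbitrary: Y rule: rtranclp_induct)
    case base
    then show ?case by blast
  next
    case (step H K)
    have H: "locally_equivalent G H" using step by (simp add: locally_equivalent_def)
    obtain Z where "Z \<subseteq> gverts H" "kernel_support H Z = kernel_support K Y"
      using local_step_kernel_support[OF locally_equivalent_looped_simple_graph[OF H \<open>looped_simple_graph G\<close>]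
        step.hyps(2)] step.prems(2) locally_equivalent_gverts[OF H] by metis
    with step.IH[OF step.prems(1)] show ?case
      by (metis locally_equivalent_gverts[OF H])
  qed
qed

section \<open>From a small support to a vertex of low degree\<close>

text \<open>
  Take a graph locally equivalent to \<open>G\<close> and a vector \<open>Y\<close> of the given support with \<open>|Y|\<close> minimal.
  If \<open>u \<in> Y\<close> had a neighbor \<open>x\<close> outside the support, then complementing at \<open>x\<close> would preserve \<open>Y\<close>
  but change the parity of \<open>|N(u) \<inter> Y|\<close>; when this is odd, complementing at \<open>u\<close> removes \<open>u\<close> from \<open>Y\<close>.
\<close>

lemma exists_low_degree:
  assumes G: "looped_simple_graph G" and "Y \<subseteq> gverts G" "Y \<noteq> {}"
  obtains H u where "locally_equivalent G H" "u \<in> gverts H"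
    "vdegree H u < card (kernel_support G Y)"
proof -
  define S where "S = kernel_support G Y"
  define P where "P = (\<lambda>(H, Z). locally_equivalent G H \<and> Z \<subseteq> gverts G \<and> kernel_support H Z = S)"
  have "P (G, Y)" using assms by (simp add: P_def S_def locally_equivalent_def)
  then obtain HZ where "P HZ" and min: "\<And>HZ'. P HZ' \<Longrightarrow> card (snd HZ) \<le> card (snd HZ')"
    using ex_has_least_nat[of P "(G, Y)" "\<lambda>p. card (snd p)"] by blast
  then obtain H Z where HZ: "HZ = (H, Z)" and H: "locally_equivalent G H"
    and Z: "Z \<subseteq> gverts G" and S: "kernel_support H Z = S"
    by (cases HZ) (auto simp: P_def)
  have finV: "finite (gverts G)" using G by (simp add: looped_simple_graph_def)
  then have finZ: "finite Z" using Z finite_subset by blast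
  \<comment> \<open>Stated for every \<open>K\<close> in which \<open>Z\<close> has support
    \<open>S\<close>, since it is applied both to \<open>H\<close> and to a local complement of
    \<open>H\<close>.\<close>
  have even: "even (card (nbrs K u \<inter> Z))"
    if "u \<in> Z" "locally_equivalent G K" "kernel_support K Z = S" for K u
  proof (rule ccontr)
    assume odd: "odd (card (nbrs K u \<inter> Z))"
    let ?K = "simple_local_complement K u"
    have K: "looped_simple_graph K" "u \<in> gverts K"
      using that G Z locally_equivalent_looped_simple_graph locally_equivalent_gverts by blast+
    have lc: "lc_vector K u Z = Z - {u}" using odd that by (auto simp: lc_vector_def)
    have "locally_equivalent G ?K"
      using that(2) K unfolding locally_equivalent_def
      by (meson local_step_def rtranclp.rtrancl_into_rtrancl)
    moreover have "kernel_support ?K (Z - {u}) = S"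
      using kernel_support_local_complement[OF K(1) _ K(2), of ?K Z] lc that by simp
    ultimately have "P (?K, Z - {u})" using Z by (auto simp: P_def)
    then have "card Z \<le> card (Z - {u})" using min HZ by fastforce
    then show False using that(1) finZ by (metis card_Diff1_less leD)
  qed
  have "S \<noteq> {}" using assms by (simp add: S_def kernel_support_empty_iff)
  then have "Z \<noteq> {}" using S kernel_support_empty_iff by metis
  then obtain u where u: "u \<in> Z" by blast
  have LH: "looped_simple_graph H" and VH: "gverts H = gverts G"
    using H G locally_equivalent_looped_simple_graph locally_equivalent_gverts by blast+
  have "nbrs H u \<subseteq> S"
  proof
    fix x assume x: "x \<in> nbrs H u"
    show "x \<in> S"
    proof (rule ccontr)
      assume nx: "x \<notin> S"
      have xV: "x \<in> gverts H" using x nbrs_subset[OF LH] by blast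
      \<comment> \<open>Lying outside the support means an even number of neighbors in
        \<open>Z\<close>, so complementing at \<open>x\<close> leaves \<open>Z\<close>
        unchanged.\<close>
      with nx S have ev: "even (card (nbrs H x \<inter> Z))" by (auto simp: kernel_support_def)
      let ?K = "simple_local_complement H x"
      have lc: "lc_vector H x Z = Z" using ev by (simp add: lc_vector_def)
      have "locally_equivalent G ?K"
        using H xV unfolding locally_equivalent_def
        by (meson local_step_def rtranclp.rtrancl_into_rtrancl)
      moreover have "kernel_support ?K Z = S"
        using kernel_support_local_complement[OF LH _ xV, of ?K Z] lc S by simp
      ultimately have "even (card (nbrs ?K u \<inter> Z))" using even u by blast
      moreover have ux: "u \<in> nbrs H x" using x nbrs_sym by metis
      moreover have "nbrs ?K u \<inter> Z = sym_diff (nbrs H u \<inter> Z) (nbrs H x \<inter> Z - {u})"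
        using nbrs_local_complement[of ?K H x u] ux by auto
      moreover have "even (card (nbrs H u \<inter> Z))" using even u H S by blast
      \<comment> \<open>Evenness at \<open>u\<close> before and after complementing forces this set
        to be even, but adding \<open>u\<close> to it gives the even set
        \<open>nbrs H x \<inter> Z\<close>.\<close>
      ultimately have "even (card (nbrs H x \<inter> Z - {u}))"
        using odd_card_sym_diff[of "nbrs H u \<inter> Z" "nbrs H x \<inter> Z - {u}"] finZ by simp
      moreover have "card (nbrs H x \<inter> Z) = Suc (card (nbrs H x \<inter> Z - {u}))"
        using ux u finZ by (intro card.remove) auto
      ultimately show False using ev by simp
    qed
  qed
  moreover have "u \<in> S" using u S by (auto simp: kernel_support_def)
  \<comment> \<open>Strict because \<open>u\<close> is in \<open>S\<close> but not in its own
    neighborhood; this supplies the one in degree plus one.\<close>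
  ultimately have "nbrs H u \<subset> S" by auto
  moreover have "finite S"
    using kernel_support_subset[OF assms(2)] finV finite_subset unfolding S_def by blast
  ultimately have "vdegree H u < card S" unfolding vdegree_def by (rule psubset_card_mono[rotated])
  then show thesis using H u Z VH by (intro that[of H u]) (auto simp: S_def)
qed

section \<open>Self-orthogonality and disjoint supports\<close>

text \<open>Both sides give the parity of the number of adjacent pairs in
  \<open>Y \<times> Z\<close>, by symmetry of adjacency.\<close>

lemma odd_nbrs_adjoint:
  assumes "finite Y" "finite Z"
  shows "even (card {u \<in> Y. odd (card (nbrs G u \<inter> Z))}) \<longleftrightarrow>
    even (card {u \<in> Z. odd (card (nbrs G u \<inter> Y))})"
proof -
  have "(\<Sum>u\<in>Y. card (nbrs G u \<inter> Z)) = (\<Sum>u\<in>Y. \<Sum>w\<in>Z. of_bool (w \<in> nbrs G u))"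
    using assms by (intro sum.cong) (auto simp: Int_commute)
  also have "\<dots> = (\<Sum>w\<in>Z. \<Sum>u\<in>Y. of_bool (w \<in> nbrs G u))" by (rule sum.swap)
  also have "\<dots> = (\<Sum>w\<in>Z. card (nbrs G w \<inter> Y))"
    using assms by (intro sum.cong) (auto simp: Int_commute Int_def nbrs_sym)
  finally show ?thesis
    using even_sum_iff[OF assms(1), of "\<lambda>u. card (nbrs G u \<inter> Z)"]
      even_sum_iff[OF assms(2), of "\<lambda>u. card (nbrs G u \<inter> Y)"] by simp
qed

text \<open>
  The map \<open>Z \<mapsto> (Z, A Z)\<close> restricted to \<open>X = kernel_support G Y\<close> has a target of at most \<open>2\<^sup>n\<close>
  elements. It is not surjective, because its image is orthogonal to the restriction of
  \<open>(A Y, Y)\<close>; hence it is not injective.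
\<close>

lemma exists_disjoint_kernel_support:
  assumes G: "looped_simple_graph G" and Y: "Y \<subseteq> gverts G" "Y \<noteq> {}"
    and small: "2 * card (kernel_support G Y) \<le> card (gverts G)"
  obtains Z where "Z \<subseteq> gverts G" "Z \<noteq> {}" "kernel_support G Z \<inter> kernel_support G Y = {}"
proof -
  define X where "X = kernel_support G Y"
  define f where "f = (\<lambda>Z. (Z \<inter> X, {v \<in> X. odd (card (nbrs G v \<inter> Z))}))"
  have finV: "finite (gverts G)" using G by (simp add: looped_simple_graph_def)
  have XV: "X \<subseteq> gverts G" using kernel_support_subset[OF Y(1)] X_def by simp
  have finX: "finite X" using XV finV finite_subset by blast
  have finY: "finite Y" using Y finV finite_subset by blast
  have ran: "f ` Pow (gverts G) \<subseteq> Pow X \<times> Pow X" by (auto simp: f_def)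
  have "\<not> inj_on f (Pow (gverts G))"
  proof
    assume "inj_on f (Pow (gverts G))"
    then have "card (f ` Pow (gverts G)) = 2 ^ card (gverts G)"
      by (simp add: card_image card_Pow finV)
    moreover have "card (Pow X \<times> Pow X) = 2 ^ (2 * card X)"
      by (simp add: card_cartesian_product card_Pow finX mult_2 power_add)
    moreover have "(2::nat) ^ (2 * card X) \<le> 2 ^ card (gverts G)"
      using small by (intro power_increasing) (auto simp: X_def)
    ultimately have surj: "f ` Pow (gverts G) = Pow X \<times> Pow X"
      using ran finX by (intro card_seteq) auto
    obtain v where v: "v \<in> Y" using Y by blast
    then have "v \<in> X" by (auto simp: X_def kernel_support_def)
    \<comment> \<open>A value not orthogonal to the restriction of (A Y, Y): the pairing picks out
      coordinate \<open>v\<close> of \<open>Y\<close>, which is 1.\<close>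
    then have "({}, {v}) \<in> f ` Pow (gverts G)" using surj by simp
    then obtain Z where Z: "Z \<subseteq> gverts G" "Z \<inter> X = {}"
      "{v \<in> X. odd (card (nbrs G v \<inter> Z))} = {v}"
      by (auto simp: f_def)
    have A: "{u \<in> Y. odd (card (nbrs G u \<inter> Z))} = {v}"
      using Z(3) v by (auto simp: X_def kernel_support_def)
    \<comment> \<open>\<open>Z\<close> avoids the support of \<open>Y\<close>, so each of its
      vertices has evenly many neighbors in \<open>Y\<close>. Adjointness would then equate the
      parities of 1 and 0.\<close>
    have B: "{u \<in> Z. odd (card (nbrs G u \<inter> Y))} = {}"
      using Z by (auto simp: X_def kernel_support_def)
    have "finite Z" using Z finV finite_subset by blast
    from odd_nbrs_adjoint[OF finY this, of G] show False unfolding A B by simp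
  qed
  then obtain Z1 Z2 where Z: "Z1 \<subseteq> gverts G" "Z2 \<subseteq> gverts G" "Z1 \<noteq> Z2" "f Z1 = f Z2"
    by (auto simp: inj_on_def)
  \<comment> \<open>The difference of two vectors with equal image vanishes, together with its
    neighbor parities, on \<open>X\<close>.\<close>
  define Z where "Z = sym_diff Z1 Z2"
  have "Z \<inter> X = {}" using Z(4) by (auto simp: f_def Z_def)
  moreover have "even (card (nbrs G v \<inter> Z))" if "v \<in> X" for v
  proof -
    have "nbrs G v \<inter> Z = sym_diff (nbrs G v \<inter> Z1) (nbrs G v \<inter> Z2)" by (auto simp: Z_def)
    moreover have "odd (card (nbrs G v \<inter> Z1)) \<longleftrightarrow> odd (card (nbrs G v \<inter> Z2))"
      using Z(4) that by (auto simp: f_def)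
    ultimately show ?thesis
      using odd_card_sym_diff[of "nbrs G v \<inter> Z1" "nbrs G v \<inter> Z2"] finite_nbrs[OF G] by auto
  qed
  ultimately have "kernel_support G Z \<inter> X = {}" by (auto simp: kernel_support_def)
  moreover have "Z \<subseteq> gverts G" "Z \<noteq> {}" using Z by (auto simp: Z_def)
  ultimately show thesis using that X_def by blast
qed

section \<open>Rank of binary column matroids\<close>

lemma bit_add_self [simp]: "a + a = (0::bit)"
  by (cases a) (simp_all add: add_bit_eq_xor)

lemma bit_add_eq_0_iff [simp]: "a + b = (0::bit) \<longleftrightarrow> a = b"
  by (cases a; cases b) simp_all

lemma UNIV_bit: "(UNIV :: bit set) = {0, 1}"
  using bit.exhaust by auto

lemma card_PiE_bit: "finite R \<Longrightarrow> card (PiE R (\<lambda>_. UNIV :: bit set)) = 2 ^ card R"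
  by (simp add: card_PiE UNIV_bit flip: numeral_2_eq_2)

lemma finite_PiE_bit: "finite R \<Longrightarrow> finite (PiE R (\<lambda>_. UNIV :: bit set))"
  by (intro finite_PiE) (auto simp: UNIV_bit)

lemma mindep_column_matroid:
  "mindep (column_matroid R W col) S \<longleftrightarrow> S \<subseteq> W \<and>
     (\<forall>c. (\<forall>u\<in>R. (\<Sum>e\<in>S. c e * col e u) = 0) \<longrightarrow> (\<forall>e\<in>S. c e = 0))"
  by (simp add: column_matroid_def)

lemma mground_column_matroid [simp]: "mground (column_matroid R W col) = W"
  by (simp add: column_matroid_def)

text \<open>
  Distinct subsets of an independent set have distinct sums of columns, and these sums lie in the
  orthogonal complement of \<open>y\<close>, a proper subset of all vectors.
\<close>

lemma card_indep_less:
  fixes col :: "'e \<Rightarrow> 'r \<Rightarrow> bit"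
  assumes R: "finite R" and I: "finite I" and ind: "mindep (column_matroid R W col) I"
    and y: "u \<in> R" "y u \<noteq> 0" "\<And>e. e \<in> I \<Longrightarrow> (\<Sum>u\<in>R. y u * col e u) = 0"
  shows "card I < card R"
proof -
  define f where "f = (\<lambda>c. restrict (\<lambda>u. \<Sum>e\<in>I. c e * col e u) R)"
  let ?A = "PiE I (\<lambda>_. UNIV :: bit set)" and ?B = "PiE R (\<lambda>_. UNIV :: bit set)"
  have "inj_on f ?A"
  proof (rule inj_onI)
    fix c d assume cd: "c \<in> ?A" "d \<in> ?A" "f c = f d"
    have "(\<Sum>e\<in>I. (c e + d e) * col e u) = 0" if "u \<in> R" for u
    proof -
      have "(\<Sum>e\<in>I. c e * col e u) = (\<Sum>e\<in>I. d e * col e u)"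
        using fun_cong[OF cd(3), of u] that by (simp add: f_def)
      then show ?thesis by (simp add: distrib_right sum.distrib)
    qed
    then have "\<forall>e\<in>I. c e + d e = 0" 
      using ind[unfolded mindep_column_matroid, THEN conjunct2, THEN spec, of "\<lambda>e. c e + d e"] by simp
    then show "c = d" using cd(1,2) by (intro PiE_ext[of c I _ d]) auto
  qed
  moreover have "f ` ?A \<subset> ?B"
  proof -
    have "f ` ?A \<subseteq> ?B" by (auto simp: f_def)
    \<comment> \<open>The unit vector at \<open>u\<close> pairs with \<open>y\<close> to
      \<open>y u\<close>, which is nonzero, whereas every combination of the columns pairs to
      zero.\<close>
    moreover have "(\<lambda>w\<in>R. of_bool (w = u)) \<notin> f ` ?A"
    proof
      assume "(\<lambda>w\<in>R. of_bool (w = u)) \<in> f ` ?A"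
      then obtain c where c: "(\<lambda>w\<in>R. of_bool (w = u)) = f c" by blast
      have eq: "(\<Sum>e\<in>I. c e * col e w) = of_bool (w = u)" if "w \<in> R" for w
        using that fun_cong[OF c, of w] by (simp add: f_def)
      have "y u = (\<Sum>w\<in>R. y w * of_bool (w = u))"
        using R y(1) by (simp add: of_bool_def if_distrib cong: if_cong)
      also have "\<dots> = (\<Sum>w\<in>R. y w * (\<Sum>e\<in>I. c e * col e w))" using eq by simp
      also have "\<dots> = (\<Sum>w\<in>R. \<Sum>e\<in>I. c e * (y w * col e w))"
        by (simp add: sum_distrib_left mult.left_commute)
      also have "\<dots> = (\<Sum>e\<in>I. \<Sum>w\<in>R. c e * (y w * col e w))" by (rule sum.swap)
      also have "\<dots> = 0" by (simp add: y(3) flip: sum_distrib_left)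
      finally show False using y(2) by simp
    qed
    ultimately show ?thesis by auto
  qed
  ultimately have "card ?A < card ?B"
    using finite_PiE_bit[OF R] by (metis card_image psubset_card_mono)
  then show ?thesis by (simp add: card_PiE_bit R I)
qed

lemma card_indep_le:
  fixes col :: "'e \<Rightarrow> 'r \<Rightarrow> bit"
  assumes R: "finite R" and I: "finite I" and ind: "mindep (column_matroid R W col) I"
  shows "card I \<le> card R"
proof -
  \<comment> \<open>An extra row which vanishes on all columns makes room for a nonzero \<open>y\<close>.\<close>
  let ?R = "insert None (Some ` R)" and ?col = "\<lambda>e. case_option 0 (col e)"
  have "card I < card ?R"
  proof (rule card_indep_less[of _ _ "W" ?col None "\<lambda>x. of_bool (x = None)"])
    show "mindep (column_matroid ?R W ?col) I"
      using ind unfolding mindep_column_matroid by auto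
  qed (auto simp: R I intro!: sum.neutral)
  then show ?thesis using R by (simp add: card_image)
qed

lemma mrank_column_matroid_obtain:
  fixes col :: "'e \<Rightarrow> 'r \<Rightarrow> 'f::field"
  assumes W: "finite W" and S: "S \<subseteq> W"
  obtains I where "I \<subseteq> S" "mindep (column_matroid R W col) I"
    "card I = mrank (column_matroid R W col) S"
    "\<And>J. J \<subseteq> S \<Longrightarrow> mindep (column_matroid R W col) J \<Longrightarrow> card J \<le> card I"
proof -
  let ?M = "column_matroid R W col"
  let ?A = "{card I | I. I \<subseteq> S \<and> mindep ?M I}"
  have finS: "finite S" using assms finite_subset by blast
  have fin: "finite ?A"
    by (rule finite_subset[of _ "card ` Pow S"]) (auto simp: finS)
  have "card {} \<in> ?A" by (force simp: mindep_column_matroid)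
  then have "Max ?A \<in> ?A" using fin by (intro Max_in) blast+
  then obtain I where "I \<subseteq> S" "mindep ?M I" "card I = mrank ?M S"
    by (auto simp: mrank_def)
  moreover have "card J \<le> mrank ?M S" if "J \<subseteq> S" "mindep ?M J" for J
    unfolding mrank_def using that fin by (intro Max_ge) blast+
  ultimately show thesis using that by metis
qed

lemma mrank_column_matroid_le:
  fixes col :: "'e \<Rightarrow> 'r \<Rightarrow> bit"
  assumes "finite R" "finite W" "S \<subseteq> W"
  shows "mrank (column_matroid R W col) S \<le> card R"
proof -
  obtain I where I: "I \<subseteq> S" "mindep (column_matroid R W col) I"
    "card I = mrank (column_matroid R W col) S"
    using mrank_column_matroid_obtain[OF assms(2,3)] by metis
  then have "finite I" using assms by (meson finite_subset)
  then show ?thesis using card_indep_le[OF assms(1) _ I(2)] I(3) by simp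
qed

text \<open>If the rank is below the number of rows, pairing vectors with a maximum independent set
  of columns is not injective, by counting. The difference of two colliding vectors annihilates this
  set, hence all columns it spans. The converse is \<open>card_indep_less\<close>.\<close>

lemma mrank_column_matroid_less_iff:
  fixes col :: "'e \<Rightarrow> 'r \<Rightarrow> bit"
  assumes R: "finite R" and W: "finite W" and S: "S \<subseteq> W"
  shows "mrank (column_matroid R W col) S < card R \<longleftrightarrow>
    (\<exists>y. (\<exists>u\<in>R. y u \<noteq> 0) \<and> (\<forall>e\<in>S. (\<Sum>u\<in>R. y u * col e u) = 0))"
    (is "?l \<longleftrightarrow> ?r")
proof -
  let ?M = "column_matroid R W col"
  obtain I where I: "I \<subseteq> S" "mindep ?M I" "card I = mrank ?M S"
    and max: "\<And>J. J \<subseteq> S \<Longrightarrow> mindep ?M J \<Longrightarrow> card J \<le> card I"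
    using mrank_column_matroid_obtain[OF W S, of R col] by metis
  have finI: "finite I" using I S W by (meson finite_subset)
  show ?thesis
  proof
    assume ?r
    then obtain y u where "u \<in> R" "y u \<noteq> 0" "\<And>e. e \<in> S \<Longrightarrow> (\<Sum>u\<in>R. y u * col e u) = 0"
      by blast
    then show ?l using card_indep_less[OF R finI I(2), of u y] I by auto
  next
    assume ?l
    define f where "f = (\<lambda>y. restrict (\<lambda>e. \<Sum>u\<in>R. y u * col e u) I)"
    let ?A = "PiE R (\<lambda>_. UNIV :: bit set)" and ?B = "PiE I (\<lambda>_. UNIV :: bit set)"
    have "card ?B < card ?A" using \<open>?l\<close> I by (simp add: card_PiE_bit R finI)
    moreover have "f ` ?A \<subseteq> ?B" by (auto simp: f_def)
    ultimately have "\<not> inj_on f ?A"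
      using finite_PiE_bit[OF finI] by (meson card_inj_on_le not_le)
    then obtain y z where yz: "y \<in> ?A" "z \<in> ?A" "f y = f z" "y \<noteq> z"
      by (auto simp: inj_on_def)
    define x where "x = (\<lambda>u. y u + z u)"
    have xI: "(\<Sum>u\<in>R. x u * col e u) = 0" if "e \<in> I" for e
    proof -
      have "(\<Sum>u\<in>R. y u * col e u) = (\<Sum>u\<in>R. z u * col e u)"
        using fun_cong[OF yz(3), of e] that by (simp add: f_def)
      then show ?thesis by (simp add: x_def distrib_right sum.distrib)
    qed
    have "\<exists>u\<in>R. x u \<noteq> 0"
    proof (rule ccontr)
      assume "\<not> (\<exists>u\<in>R. x u \<noteq> 0)"
      then have "\<forall>u\<in>R. y u = z u" by (simp add: x_def)
      then show False using yz by (metis PiE_ext)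
    qed
    moreover have "(\<Sum>u\<in>R. x u * col e u) = 0" if e: "e \<in> S" "e \<notin> I" for e
    proof -
      \<comment> \<open>By maximality \<open>e\<close> takes part in a dependency with
        \<open>I\<close>. Its coefficient is 1, as otherwise \<open>I\<close> would be dependent, so
        column \<open>e\<close> is a combination of columns of \<open>I\<close>.\<close>
      have "\<not> mindep ?M (insert e I)"
        using max[of "insert e I"] e I finI by auto
      then obtain c where c: "\<forall>u\<in>R. (\<Sum>e\<in>insert e I. c e * col e u) = 0"
          "\<exists>e\<in>insert e I. c e \<noteq> 0"
        using S e I unfolding mindep_column_matroid by auto
      have eq: "c e * col e u = (\<Sum>d\<in>I. c d * col d u)" if "u \<in> R" for u
        using c(1) that finI e by simp
      have "c e = 1"
      proof (rule ccontr)
        assume "c e \<noteq> 1"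
        then have "c e = 0" by simp
        then have "\<forall>u\<in>R. (\<Sum>d\<in>I. c d * col d u) = 0" using eq by simp
        then have "\<forall>d\<in>I. c d = 0" using I(2) unfolding mindep_column_matroid by blast
        then show False using c(2) \<open>c e = 0\<close> by simp
      qed
      then have "(\<Sum>u\<in>R. x u * col e u) = (\<Sum>u\<in>R. x u * (\<Sum>d\<in>I. c d * col d u))"
        using eq by simp
      also have "\<dots> = (\<Sum>u\<in>R. \<Sum>d\<in>I. c d * (x u * col d u))"
        by (simp add: sum_distrib_left mult.left_commute)
      also have "\<dots> = (\<Sum>d\<in>I. \<Sum>u\<in>R. c d * (x u * col d u))" by (rule sum.swap)
      also have "\<dots> = 0" by (simp add: xI flip: sum_distrib_left)
      finally show ?thesis .
    qed
    ultimately show ?r using xI by blast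
  qed
qed

section \<open>Vertical connectivity through nonspanning sets\<close>

text \<open>For a vertical \<open>k\<close>-separation, \<open>mconn M S < k\<close> and
  \<open>k\<close> at most either rank bound the other rank below the rank of \<open>M\<close>.
  Conversely, with \<open>k\<close> the smaller of the two ranks, \<open>mconn M S < k\<close> says
  just that the larger one is below the rank of \<open>M\<close>.\<close>

lemma vertical_connectivity_less_iff:
  "vertical_connectivity M < mrank M (mground M) \<longleftrightarrow>
    (\<exists>S \<subseteq> mground M. mrank M S < mrank M (mground M) \<and>
      mrank M (mground M - S) < mrank M (mground M))" (is "?l \<longleftrightarrow> ?r")
proof
  let ?K = "{k. \<exists>S. vertical_separation M k S} \<union> {mrank M (mground M)}"
  assume ?l
  moreover have "vertical_connectivity M \<in> ?K"
    unfolding vertical_connectivity_def by (rule Inf_nat_def1) blast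
  ultimately obtain S where "vertical_separation M (vertical_connectivity M) S" by auto
  then show ?r unfolding vertical_separation_def mconn_def by (intro exI[of _ S]) auto
next
  let ?K = "{k. \<exists>S. vertical_separation M k S} \<union> {mrank M (mground M)}"
  assume ?r
  then obtain S where S: "S \<subseteq> mground M" "mrank M S < mrank M (mground M)"
    "mrank M (mground M - S) < mrank M (mground M)" by blast
  let ?k = "min (mrank M S) (mrank M (mground M - S))"
  have "vertical_separation M ?k S"
    using S unfolding vertical_separation_def mconn_def by auto
  then have "vertical_connectivity M \<le> ?k"
    unfolding vertical_connectivity_def by (intro cInf_lower) auto
  then show ?l using S by simp
qed

section \<open>Kernel supports and sums of columns\<close>

lemma of_nat_bit: "of_nat k = (of_bool (odd k) :: bit)"
  by (induction k) auto

definition adj_mult :: "'a looped_graph \<Rightarrow> ('a \<Rightarrow> bit) \<Rightarrow> 'a \<Rightarrow> bit" where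
  "adj_mult G y u = (\<Sum>v\<in>gverts G. y v * adj_matrix G u v)"

text \<open>The diagonal entry is multiplied by \<open>y v\<close>, so a loop can matter only when
  \<open>v\<close> is in the support anyway; the remaining sum counts non-loop neighbors modulo
  2.\<close>

lemma mem_kernel_support_iff:
  assumes G: "looped_simple_graph G" and v: "v \<in> gverts G"
  shows "v \<in> kernel_support G {u \<in> gverts G. y u = 1} \<longleftrightarrow> y v = 1 \<or> adj_mult G y v = 1"
proof -
  let ?Y = "{u \<in> gverts G. y u = 1}"
  have fin: "finite (gverts G)" using G by (simp add: looped_simple_graph_def)
  have "adj_mult G y v = y v * adj_matrix G v v + (\<Sum>u\<in>gverts G - {v}. y u * adj_matrix G v u)"
    unfolding adj_mult_def using fin v by (rule sum.remove)
  also have "(\<Sum>u\<in>gverts G - {v}. y u * adj_matrix G v u)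
      = (\<Sum>u\<in>gverts G - {v}. of_bool (u \<in> nbrs G v \<inter> ?Y))"
    by (rule sum.cong) (auto simp: nbrs_def adj_matrix_def)
  also have "\<dots> = of_nat (card ((gverts G - {v}) \<inter> (nbrs G v \<inter> ?Y)))"
    using fin by (auto simp: Int_def intro!: arg_cong[where f = card] arg_cong[where f = of_nat])
  also have "(gverts G - {v}) \<inter> (nbrs G v \<inter> ?Y) = nbrs G v \<inter> ?Y" by auto
  finally have "adj_mult G y v = y v * adj_matrix G v v + of_bool (odd (card (nbrs G v \<inter> ?Y)))"
    by (simp add: of_nat_bit)
  then show ?thesis using v by (cases "y v") (auto simp: kernel_support_def)
qed

lemma finite_vertex_triples: "finite V \<Longrightarrow> finite (vertex_triples V)"
  by (simp add: vertex_triples_def vertex_triple_def)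

lemma mem_vertex_triples [simp]:
  "Phi v \<in> vertex_triples X \<longleftrightarrow> v \<in> X"
  "Chi v \<in> vertex_triples X \<longleftrightarrow> v \<in> X"
  "Psi v \<in> vertex_triples X \<longleftrightarrow> v \<in> X"
  by (auto simp: vertex_triples_def vertex_triple_def)

lemma vertex_triples_ball:
  "(\<forall>e\<in>vertex_triples X. P e) \<longleftrightarrow> (\<forall>v\<in>X. P (Phi v) \<and> P (Chi v) \<and> P (Psi v))"
  by (auto simp: vertex_triples_def vertex_triple_def)

lemma sum_vertex_triples:
  assumes "finite V"
  shows "sum f (vertex_triples V) = (\<Sum>v\<in>V. f (Phi v) + f (Chi v) + f (Psi v))"
  unfolding vertex_triples_def using assms
  by (subst sum.UNION_disjoint) (auto simp: vertex_triple_def add.assoc)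

text \<open>A \<open>Psi\<close> column is the sum of the \<open>Phi\<close> and \<open>Chi\<close>
  columns of its vertex, so its coefficient is added to both of theirs.\<close>

lemma sum_ias_column:
  assumes "finite (gverts G)" "u \<in> gverts G"
  shows "(\<Sum>e\<in>vertex_triples (gverts G). c e * ias_column G e u) =
    c (Phi u) + c (Psi u) + adj_mult G (\<lambda>v. c (Chi v) + c (Psi v)) u"
proof -
  have "(\<Sum>e\<in>vertex_triples (gverts G). c e * ias_column G e u)
      = (\<Sum>v\<in>gverts G. (c (Phi v) + c (Psi v)) * of_bool (u = v)
          + (c (Chi v) + c (Psi v)) * adj_matrix G u v)"
    using assms by (simp add: sum_vertex_triples algebra_simps)
  also have "\<dots> = (\<Sum>v\<in>gverts G. (c (Phi v) + c (Psi v)) * of_bool (u = v))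
      + adj_mult G (\<lambda>v. c (Chi v) + c (Psi v)) u"
    by (simp add: sum.distrib adj_mult_def)
  also have "(\<Sum>v\<in>gverts G. (c (Phi v) + c (Psi v)) * of_bool (u = v)) = c (Phi u) + c (Psi u)"
    using assms by (simp add: of_bool_def if_distrib cong: if_cong)
  finally show ?thesis .
qed

section \<open>Transverse circuits and kernel vectors\<close>

lemma exists_mcircuit:
  assumes "finite D" "D \<subseteq> mground M" "\<not> mindep M D"
  obtains C where "C \<subseteq> D" "mcircuit M C"
proof -
  obtain C where C: "C \<subseteq> D \<and> \<not> mindep M C"
    and min: "\<And>E. E \<subseteq> D \<and> \<not> mindep M E \<Longrightarrow> card C \<le> card E"
    using ex_has_least_nat[of "\<lambda>C. C \<subseteq> D \<and> \<not> mindep M C" D card] assms by blast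
  have "mindep M E" if "E \<subset> C" for E
  proof (rule ccontr)
    assume "\<not> mindep M E"
    then have "card C \<le> card E" using min[of E] that C by blast
    moreover have "card E < card C"
      using that C assms(1) by (meson finite_subset psubset_card_mono)
    ultimately show False by simp
  qed
  then show thesis using that[of C] C assms by (auto simp: mcircuit_def)
qed

text \<open>At each vertex of the support, choose the element by the coordinates of (A Y, Y):
  \<open>Phi\<close> for (1, 0), \<open>Chi\<close> for (0, 1), \<open>Psi\<close> for (1, 1). The
  chosen columns sum to zero, so they contain a circuit, possibly a smaller one.\<close>

lemma transverse_circuit_of_vector:
  assumes G: "looped_simple_graph G" and Y: "Y \<subseteq> gverts G" "Y \<noteq> {}"
  obtains C where "transverse_circuit G C" "C \<subseteq> vertex_triples (kernel_support G Y)"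
    "card C \<le> card (kernel_support G Y)"
proof -
  define y :: "'a \<Rightarrow> bit" where "y = (\<lambda>v. of_bool (v \<in> Y))"
  define X where "X = kernel_support G Y"
  define el where "el = (\<lambda>v. if y v = 0 then Phi v else if adj_mult G y v = 0 then Chi v else Psi v)"
  have fin: "finite (gverts G)" using G by (simp add: looped_simple_graph_def)
  have XV: "X \<subseteq> gverts G" using Y kernel_support_subset X_def by metis
  have "Y = {u \<in> gverts G. y u = 1}" using Y by (auto simp: y_def)
  then have X: "v \<in> X \<longleftrightarrow> y v = 1 \<or> adj_mult G y v = 1" if "v \<in> gverts G" for v
    using mem_kernel_support_iff[OF G that, of y] by (simp add: X_def)
  define D where "D = el ` X"
  have "finite X" using XV fin finite_subset by blast
  then have "finite D" "card D \<le> card X" by (simp_all add: D_def card_image_le)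
  have memD: "Phi v \<in> D \<longleftrightarrow> v \<in> gverts G \<and> y v = 0 \<and> adj_mult G y v = 1"
    "Chi v \<in> D \<longleftrightarrow> v \<in> gverts G \<and> y v = 1 \<and> adj_mult G y v = 0"
    "Psi v \<in> D \<longleftrightarrow> v \<in> gverts G \<and> y v = 1 \<and> adj_mult G y v = 1" for v
    using X XV by (auto simp: D_def el_def image_iff split: if_splits)
  have DX: "D \<subseteq> vertex_triples X"
    by (auto simp: D_def el_def)
  have DV: "D \<subseteq> vertex_triples (gverts G)"
    using DX XV by (auto simp: vertex_triples_def)
  have "\<not> mindep (ias_matroid G) D"
  proof
    assume ind: "mindep (ias_matroid G) D"
    define c :: "'a ias_elem \<Rightarrow> bit" where "c = (\<lambda>e. of_bool (e \<in> D))"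
    have "(\<Sum>e\<in>D. c e * ias_column G e u) = 0" if "u \<in> gverts G" for u
    proof -
      have "(\<Sum>e\<in>D. c e * ias_column G e u) = (\<Sum>e\<in>vertex_triples (gverts G). c e * ias_column G e u)"
        using DV finite_vertex_triples[OF fin] by (intro sum.mono_neutral_left) (auto simp: c_def)
      also have "\<dots> = c (Phi u) + c (Psi u) + adj_mult G (\<lambda>v. c (Chi v) + c (Psi v)) u"
        by (rule sum_ias_column[OF fin that])
      also have "adj_mult G (\<lambda>v. c (Chi v) + c (Psi v)) u = adj_mult G y u"
        unfolding adj_mult_def by (rule sum.cong) (auto simp: c_def memD)
      also have "c (Phi u) + c (Psi u) = adj_mult G y u"
        using that by (auto simp: c_def memD)
      finally show ?thesis by simp
    qed
    then have "\<forall>e\<in>D. c e = 0"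
      using ind unfolding ias_matroid_def mindep_column_matroid by blast
    then have "D = {}" by (auto simp: c_def)
    then show False using Y by (auto simp: D_def X_def kernel_support_def)
  qed
  moreover have "mground (ias_matroid G) = vertex_triples (gverts G)"
    by (simp add: ias_matroid_def)
  ultimately obtain C where C: "C \<subseteq> D" "mcircuit (ias_matroid G) C"
    using exists_mcircuit[of D "ias_matroid G"] \<open>finite D\<close> DV by metis
  \<comment> \<open>Off the support \<open>el\<close> takes the value \<open>Phi\<close>, which
    completes \<open>D\<close> to a transversal.\<close>
  have "transversal G (el ` gverts G)"
    unfolding transversal_def
  proof (intro conjI ballI)
    show "el ` gverts G \<subseteq> vertex_triples (gverts G)" by (auto simp: el_def)
    fix v assume "v \<in> gverts G"
    then have "el ` gverts G \<inter> vertex_triple v = {el v}"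
      by (auto simp: el_def vertex_triple_def split: if_splits)
    then show "card (el ` gverts G \<inter> vertex_triple v) = 1" by simp
  qed
  then have "transverse_circuit G C"
    using C XV unfolding D_def transverse_circuit_def by blast
  moreover have "card C \<le> card D" using C \<open>finite D\<close> by (simp add: card_mono)
  ultimately show thesis
    using that[of C] C DX \<open>card D \<le> card X\<close> X_def by auto
qed

text \<open>A dependency among the columns of \<open>C\<close>, extended by zero, has the form (A Y,
  Y) once the \<open>Psi\<close> coefficients are split. Its support involves only vertices whose
  triples meet \<open>C\<close>.\<close>

lemma vector_of_transverse_circuit:
  assumes G: "looped_simple_graph G" and C: "transverse_circuit G C"
  obtains Y where "Y \<subseteq> gverts G" "Y \<noteq> {}" "card (kernel_support G Y) \<le> card C"
    "\<And>X. C \<subseteq> vertex_triples X \<Longrightarrow> kernel_support G Y \<subseteq> X"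
proof -
  have fin: "finite (gverts G)" using G by (simp add: looped_simple_graph_def)
  obtain T where T: "transversal G T" "C \<subseteq> T" using C by (auto simp: transverse_circuit_def)
  have CV: "C \<subseteq> vertex_triples (gverts G)" using T by (auto simp: transversal_def)
  have finC: "finite C" using CV finite_vertex_triples[OF fin] finite_subset by blast
  have "\<not> mindep (ias_matroid G) C" using C by (simp add: transverse_circuit_def mcircuit_def)
  then obtain c where c: "\<forall>u\<in>gverts G. (\<Sum>e\<in>C. c e * ias_column G e u) = 0" "\<exists>e\<in>C. c e \<noteq> 0"
    using CV unfolding ias_matroid_def mindep_column_matroid by blast
  define d where "d = (\<lambda>e. if e \<in> C then c e else 0)"
  define y where "y = (\<lambda>v. d (Chi v) + d (Psi v))"
  define Y where "Y = {v \<in> gverts G. y v = 1}"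
  have Ay: "adj_mult G y u = d (Phi u) + d (Psi u)" if "u \<in> gverts G" for u
  proof -
    have "0 = (\<Sum>e\<in>C. c e * ias_column G e u)" using c that by simp
    also have "\<dots> = (\<Sum>e\<in>vertex_triples (gverts G). d e * ias_column G e u)"
      using CV finite_vertex_triples[OF fin]
      by (intro sum.mono_neutral_cong_left) (auto simp: d_def)
    also have "\<dots> = d (Phi u) + d (Psi u) + adj_mult G y u"
      unfolding y_def by (rule sum_ias_column[OF fin that])
    finally show ?thesis by (metis bit_add_eq_0_iff)
  qed
  have YV: "Y \<subseteq> gverts G" by (auto simp: Y_def)
  have supp: "Phi v \<in> C \<or> Chi v \<in> C \<or> Psi v \<in> C" if "v \<in> kernel_support G Y" for v
  proof -
    have v: "v \<in> gverts G" using that kernel_support_subset[OF YV] by blast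
    have "y v = 1 \<or> adj_mult G y v = 1"
      using that mem_kernel_support_iff[OF G v, of y] by (simp add: Y_def)
    then show ?thesis using Ay[OF v] by (auto simp: y_def d_def split: if_splits)
  qed
  \<comment> \<open>Otherwise \<open>d\<close> is constant on each triple, and a triple where it is
    1 would have at least two elements in the transversal \<open>T\<close>.\<close>
  have "Y \<noteq> {}"
  proof
    assume "Y = {}"
    then have y0: "y v = 0" if "v \<in> gverts G" for v using that by (auto simp: Y_def)
    then have "adj_mult G y v = 0" for v by (simp add: adj_mult_def)
    then have eq: "d (Phi v) = d (Psi v)" "d (Chi v) = d (Psi v)" if "v \<in> gverts G" for v
      using Ay[OF that] y0[OF that] by (auto simp: y_def)
    obtain e where e: "e \<in> C" "d e = 1" using c(2) by (auto simp: d_def)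
    then obtain v where v: "v \<in> gverts G" "e \<in> vertex_triple v"
      using CV by (auto simp: vertex_triples_def)
    then have "d (Phi v) = 1" "d (Chi v) = 1" using e eq[OF v(1)] by (auto simp: vertex_triple_def)
    then have "{Phi v, Chi v} \<subseteq> T \<inter> vertex_triple v"
      using T by (auto simp: d_def vertex_triple_def split: if_splits)
    moreover obtain x where "T \<inter> vertex_triple v = {x}"
      using T v card_1_singletonE by (metis transversal_def)
    ultimately show False by auto
  qed
  moreover have "card (kernel_support G Y) \<le> card C"
  proof -
    define vx where "vx = (\<lambda>e. case e of Phi v \<Rightarrow> v | Chi v \<Rightarrow> v | Psi v \<Rightarrow> (v::'a))"
    have "kernel_support G Y \<subseteq> vx ` C"
    proof
      fix v assume "v \<in> kernel_support G Y"
      from supp[OF this] show "v \<in> vx ` C" by (force simp: vx_def image_iff)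
    qed
    then show ?thesis using finC surj_card_le by blast
  qed
  moreover have "kernel_support G Y \<subseteq> X" if "C \<subseteq> vertex_triples X" for X
    using supp that mem_vertex_triples by (metis subset_iff)
  ultimately show thesis using that YV by blast
qed

section \<open>Rank and connectivity of the isotropic matroid\<close>

text \<open>Symmetry of the adjacency matrix gives the \<open>Chi\<close> case. Consequently
  \<open>y\<close> annihilates a whole triple exactly when the vertex is off its kernel
  support.\<close>

lemma orthogonal_ias_column:
  assumes "finite (gverts G)" "v \<in> gverts G"
  shows "(\<Sum>u\<in>gverts G. y u * ias_column G (Phi v) u) = y v"
    and "(\<Sum>u\<in>gverts G. y u * ias_column G (Chi v) u) = adj_mult G y v"
    and "(\<Sum>u\<in>gverts G. y u * ias_column G (Psi v) u) = adj_mult G y v + y v"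
proof -
  show 1: "(\<Sum>u\<in>gverts G. y u * ias_column G (Phi v) u) = y v"
    using assms by (simp add: of_bool_def if_distrib cong: if_cong)
  show 2: "(\<Sum>u\<in>gverts G. y u * ias_column G (Chi v) u) = adj_mult G y v"
    unfolding adj_mult_def by (rule sum.cong) (simp_all add: adj_matrix_def insert_commute)
  have "(\<Sum>u\<in>gverts G. y u * ias_column G (Psi v) u)
      = (\<Sum>u\<in>gverts G. y u * ias_column G (Chi v) u + y u * ias_column G (Phi v) u)"
    by (rule sum.cong) (simp_all add: distrib_left)
  then show "(\<Sum>u\<in>gverts G. y u * ias_column G (Psi v) u) = adj_mult G y v + y v"
    unfolding sum.distrib 1 2 .
qed

lemma mrank_ias_matroid_less_iff:
  assumes "finite (gverts G)" "S \<subseteq> vertex_triples (gverts G)"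
  shows "mrank (ias_matroid G) S < card (gverts G) \<longleftrightarrow>
    (\<exists>y. (\<exists>u\<in>gverts G. y u = 1) \<and> (\<forall>e\<in>S. (\<Sum>u\<in>gverts G. y u * ias_column G e u) = 0))"
  using mrank_column_matroid_less_iff[OF assms(1) finite_vertex_triples[OF assms(1)] assms(2)]
  by (simp add: ias_matroid_def)

text \<open>The \<open>Phi\<close> columns form an identity matrix, so no nonzero vector annihilates
  all columns.\<close>

lemma mrank_ias_matroid:
  assumes "finite (gverts G)"
  shows "mrank (ias_matroid G) (mground (ias_matroid G)) = card (gverts G)"
proof -
  have "\<not> mrank (ias_matroid G) (vertex_triples (gverts G)) < card (gverts G)"
  proof
    assume "mrank (ias_matroid G) (vertex_triples (gverts G)) < card (gverts G)"
    then obtain y u where u: "u \<in> gverts G" "y u = 1"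
      "\<forall>e\<in>vertex_triples (gverts G). (\<Sum>u\<in>gverts G. y u * ias_column G e u) = 0"
      using mrank_ias_matroid_less_iff[OF assms subset_refl] by metis
    then have "(\<Sum>w\<in>gverts G. y w * ias_column G (Phi u) w) = 0" by (metis mem_vertex_triples(1))
    then show False using u(2) orthogonal_ias_column(1)[OF assms u(1), of y] by simp
  qed
  moreover have "mrank (ias_matroid G) (vertex_triples (gverts G)) \<le> card (gverts G)"
    unfolding ias_matroid_def
    by (rule mrank_column_matroid_le[OF assms finite_vertex_triples[OF assms] subset_refl])
  ultimately show ?thesis by (simp add: ias_matroid_def)
qed

text \<open>
  If \<open>y\<close> annihilates \<open>S\<close> and \<open>z\<close> annihilates its complement, then one of them annihilates two, and
  hence all three, elements of any given vertex triple, whose columns add up to zero.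
\<close>

lemma vertical_connectivity_ias_less_iff:
  assumes G: "looped_simple_graph G"
  shows "vertical_connectivity (ias_matroid G) < card (gverts G) \<longleftrightarrow>
    (\<exists>Y Z. Y \<subseteq> gverts G \<and> Z \<subseteq> gverts G \<and> Y \<noteq> {} \<and> Z \<noteq> {} \<and>
      kernel_support G Y \<inter> kernel_support G Z = {})" (is "?l \<longleftrightarrow> ?r")
proof -
  let ?V = "gverts G" and ?M = "ias_matroid G"
  let ?W = "vertex_triples ?V"
  have fin: "finite ?V" using G by (simp add: looped_simple_graph_def)
  have W: "mground ?M = ?W" by (simp add: ias_matroid_def)
  note rank = mrank_ias_matroid[OF fin]
  from vertical_connectivity_less_iff[of ?M, unfolded rank, unfolded W]
  have main: "?l \<longleftrightarrow> (\<exists>S \<subseteq> ?W. mrank ?M S < card ?V \<and> mrank ?M (?W - S) < card ?V)" .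
  show ?thesis
  proof
    assume ?l
    then obtain S where S: "S \<subseteq> ?W" "mrank ?M S < card ?V" "mrank ?M (?W - S) < card ?V"
      using main by blast
    obtain y where y: "\<exists>u\<in>?V. y u = 1" "\<forall>e\<in>S. (\<Sum>u\<in>?V. y u * ias_column G e u) = 0"
      using S mrank_ias_matroid_less_iff[OF fin, of S] by auto
    obtain z where z: "\<exists>u\<in>?V. z u = 1" "\<forall>e\<in>?W - S. (\<Sum>u\<in>?V. z u * ias_column G e u) = 0"
      using S mrank_ias_matroid_less_iff[OF fin, of "?W - S"] by auto
    let ?Y = "{v \<in> ?V. y v = 1}" and ?Z = "{v \<in> ?V. z v = 1}"
    have YV: "?Y \<subseteq> ?V" and ZV: "?Z \<subseteq> ?V" by auto
    have "v \<notin> kernel_support G ?Y \<inter> kernel_support G ?Z" for v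
    proof
      assume v: "v \<in> kernel_support G ?Y \<inter> kernel_support G ?Z"
      then have vV: "v \<in> ?V" using kernel_support_subset[OF YV] by blast
      have a: "y v = 1 \<or> adj_mult G y v = 1" "z v = 1 \<or> adj_mult G z v = 1"
        using v mem_kernel_support_iff[OF G vV] by auto
      note oy = orthogonal_ias_column[OF fin vV, of y] and oz = orthogonal_ias_column[OF fin vV, of z]
      have "Phi v \<in> S \<Longrightarrow> y v = 0" "Chi v \<in> S \<Longrightarrow> adj_mult G y v = 0"
          "Psi v \<in> S \<Longrightarrow> adj_mult G y v = y v"
        using y(2) oy by (metis bit_add_eq_0_iff)+
      moreover have "Phi v \<notin> S \<Longrightarrow> z v = 0" "Chi v \<notin> S \<Longrightarrow> adj_mult G z v = 0"
          "Psi v \<notin> S \<Longrightarrow> adj_mult G z v = z v"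
        using z(2) oz vV by (metis DiffI bit_add_eq_0_iff mem_vertex_triples)+
      ultimately show False using a
        by (cases "Phi v \<in> S"; cases "Chi v \<in> S"; cases "Psi v \<in> S") auto
    qed
    then have "kernel_support G ?Y \<inter> kernel_support G ?Z = {}" by blast
    moreover have "?Y \<noteq> {}" "?Z \<noteq> {}" using y(1) z(1) by auto
    ultimately show ?r using YV ZV by blast
  next
    assume ?r
    then obtain Y Z where YZ: "Y \<subseteq> ?V" "Z \<subseteq> ?V" "Y \<noteq> {}" "Z \<noteq> {}"
      "kernel_support G Y \<inter> kernel_support G Z = {}" by blast
    have nonspan: "mrank ?M S < card ?V"
      if U: "U \<subseteq> ?V" "U \<noteq> {}" and S: "S \<subseteq> vertex_triples (?V - kernel_support G U)" for U S
    proof -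
      define y :: "'a \<Rightarrow> bit" where "y = (\<lambda>v. of_bool (v \<in> U))"
      have U': "U = {v \<in> ?V. y v = 1}" using U by (auto simp: y_def)
      have "\<exists>u\<in>?V. y u = 1" using U by (auto simp: y_def)
      moreover have "\<forall>e\<in>vertex_triples (?V - kernel_support G U). (\<Sum>u\<in>?V. y u * ias_column G e u) = 0"
        unfolding vertex_triples_ball
      proof
        fix v assume v: "v \<in> ?V - kernel_support G U"
        then have vV: "v \<in> ?V" by blast
        have "y v = 0" "adj_mult G y v = 0"
          using v mem_kernel_support_iff[OF G vV, of y] U' by auto
        then show "(\<Sum>u\<in>?V. y u * ias_column G (Phi v) u) = 0 \<and>
            (\<Sum>u\<in>?V. y u * ias_column G (Chi v) u) = 0 \<and> (\<Sum>u\<in>?V. y u * ias_column G (Psi v) u) = 0"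
          unfolding orthogonal_ias_column[OF fin vV] by simp
      qed
      moreover have "S \<subseteq> ?W" using S by (auto simp: vertex_triples_def)
      ultimately show ?thesis using S mrank_ias_matroid_less_iff[OF fin, of S] by blast
    qed
    \<comment> \<open>\<open>Y\<close> annihilates these triples. The remaining triples belong to
      the support of \<open>Y\<close>, so by disjointness \<open>Z\<close> annihilates them.\<close>
    let ?S = "vertex_triples (?V - kernel_support G Y)"
    have "mrank ?M ?S < card ?V" using nonspan YZ by blast
    moreover have "?W - ?S \<subseteq> vertex_triples (?V - kernel_support G Z)"
      using YZ(5) by (auto simp: vertex_triples_def)
    then have "mrank ?M (?W - ?S) < card ?V" using nonspan YZ by blast
    moreover have "?S \<subseteq> ?W" by (auto simp: vertex_triples_def)
    ultimately show ?l using main by blast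
  qed
qed

section \<open>The four conditions expressed by kernel supports\<close>

theorem theorem29:
  fixes G :: "'a looped_graph" and M :: "'a ias_elem matroid" and n :: nat
  assumes "looped_simple_graph G"
    and "n = card (gverts G)" and "n \<ge> 4"
    and "M = ias_matroid G"
  shows "((\<exists>H. locally_equivalent G H \<and> (\<exists>v\<in>gverts H. real (vdegree H v) < (real n - 1) / 2))
            \<longleftrightarrow> (\<exists>C. transverse_circuit G C \<and> real (card C) < (real n + 1) / 2))
       \<and> ((\<exists>C. transverse_circuit G C \<and> real (card C) < (real n + 1) / 2)
            \<longleftrightarrow> (\<exists>X \<subseteq> gverts G.
                  (\<exists>C. transverse_circuit G C \<and> C \<subseteq> vertex_triples X) \<and>
                  (\<exists>C. transverse_circuit G C \<and> C \<subseteq> vertex_triples (gverts G - X))))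
       \<and> ((\<exists>X \<subseteq> gverts G.
                  (\<exists>C. transverse_circuit G C \<and> C \<subseteq> vertex_triples X) \<and>
                  (\<exists>C. transverse_circuit G C \<and> C \<subseteq> vertex_triples (gverts G - X)))
            \<longleftrightarrow> vertical_connectivity M < n)"
    (is "(?A \<longleftrightarrow> ?B) \<and> (?B \<longleftrightarrow> ?C) \<and> (?C \<longleftrightarrow> ?D)")
proof -
  note G = assms(1)
  let ?V = "gverts G"
  let ?vec = "\<lambda>Y. Y \<subseteq> ?V \<and> Y \<noteq> {}"
  have fin: "finite ?V" using G by (simp add: looped_simple_graph_def)
  have B: "?B \<longleftrightarrow> (\<exists>Y. ?vec Y \<and> 2 * card (kernel_support G Y) \<le> n)"
  proof
    assume ?B
    then obtain C where "transverse_circuit G C" "2 * card C \<le> n" by auto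
    then show "\<exists>Y. ?vec Y \<and> 2 * card (kernel_support G Y) \<le> n"
      using vector_of_transverse_circuit[OF G, of C] by (metis dual_order.trans mult_le_mono2)
  next
    assume "\<exists>Y. ?vec Y \<and> 2 * card (kernel_support G Y) \<le> n"
    then obtain Y where Y: "?vec Y" "2 * card (kernel_support G Y) \<le> n" by blast
    obtain C where "transverse_circuit G C" "card C \<le> card (kernel_support G Y)"
      using transverse_circuit_of_vector[OF G, of Y] Y(1) by metis
    then show ?B using Y(2) by (intro exI[of _ C]) auto
  qed
  have C: "?C \<longleftrightarrow> (\<exists>Y Z. ?vec Y \<and> ?vec Z \<and> kernel_support G Y \<inter> kernel_support G Z = {})"
  proof
    assume ?C
    then obtain X C1 C2 where X: "X \<subseteq> ?V" "transverse_circuit G C1" "C1 \<subseteq> vertex_triples X"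
      "transverse_circuit G C2" "C2 \<subseteq> vertex_triples (?V - X)" by blast
    obtain Y where Y: "?vec Y" "kernel_support G Y \<subseteq> X"
      using vector_of_transverse_circuit[OF G X(2)] X(3) by metis
    obtain Z where Z: "?vec Z" "kernel_support G Z \<subseteq> ?V - X"
      using vector_of_transverse_circuit[OF G X(4)] X(5) by metis
    have "kernel_support G Y \<inter> kernel_support G Z = {}" using Y(2) Z(2) by blast
    with Y(1) Z(1) show "\<exists>Y Z. ?vec Y \<and> ?vec Z \<and> kernel_support G Y \<inter> kernel_support G Z = {}"
      by blast
  next
    assume "\<exists>Y Z. ?vec Y \<and> ?vec Z \<and> kernel_support G Y \<inter> kernel_support G Z = {}"
    then obtain Y Z where YZ: "?vec Y" "?vec Z" "kernel_support G Y \<inter> kernel_support G Z = {}"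
      by blast
    obtain C1 where C1: "transverse_circuit G C1" "C1 \<subseteq> vertex_triples (kernel_support G Y)"
      using transverse_circuit_of_vector[OF G, of Y] YZ(1) by metis
    obtain C2 where C2: "transverse_circuit G C2" "C2 \<subseteq> vertex_triples (kernel_support G Z)"
      using transverse_circuit_of_vector[OF G, of Z] YZ(2) by metis
    \<comment> \<open>The support of \<open>Y\<close> serves as the witness
      \<open>X\<close>.\<close>
    have "kernel_support G Z \<subseteq> ?V - kernel_support G Y"
      using YZ kernel_support_subset[of Z G] by blast
    then have "C2 \<subseteq> vertex_triples (?V - kernel_support G Y)"
      using C2(2) unfolding vertex_triples_def by blast
    moreover have "kernel_support G Y \<subseteq> ?V" using YZ(1) kernel_support_subset by metis
    ultimately show ?C using C1 C2(1) by blast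
  qed
  have "?A \<longleftrightarrow> (\<exists>Y. ?vec Y \<and> 2 * card (kernel_support G Y) \<le> n)"
  proof
    assume ?A
    then obtain H v where H: "locally_equivalent G H" and v: "v \<in> gverts H"
      and "real (vdegree H v) < (real n - 1) / 2" by blast
    \<comment> \<open>By integrality; the successor of the degree is the size of the support of
      \<open>{v}\<close> in \<open>H\<close>.\<close>
    then have deg: "2 * Suc (vdegree H v) \<le> n" by auto
    have LH: "looped_simple_graph H" and VH: "gverts H = ?V"
      using H G locally_equivalent_looped_simple_graph locally_equivalent_gverts by blast+
    obtain Z where Z: "Z \<subseteq> ?V" "kernel_support G Z = insert v (nbrs H v)"
      using locally_equivalent_kernel_support[OF H G, of "{v}"] v VH
      by (auto simp: kernel_support_singleton[OF LH])
    then have "Z \<noteq> {}" using kernel_support_empty_iff[of G Z] by auto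
    moreover have "card (insert v (nbrs H v)) = Suc (vdegree H v)"
      using finite_nbrs[OF LH] by (simp add: vdegree_def)
    ultimately show "\<exists>Y. ?vec Y \<and> 2 * card (kernel_support G Y) \<le> n"
      using Z deg by (intro exI[of _ Z]) simp
  next
    assume "\<exists>Y. ?vec Y \<and> 2 * card (kernel_support G Y) \<le> n"
    then obtain Y where Y: "?vec Y" "2 * card (kernel_support G Y) \<le> n" by blast
    obtain H u where H: "locally_equivalent G H" "u \<in> gverts H"
      "vdegree H u < card (kernel_support G Y)"
      using exists_low_degree[OF G, of Y] Y(1) by metis
    then have "2 * vdegree H u + 2 \<le> n" using Y(2) by linarith
    then have "real (2 * vdegree H u + 2) \<le> real n" unfolding of_nat_le_iff .
    then have "real (vdegree H u) < (real n - 1) / 2" by simp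
    with H show ?A by blast
  qed
  moreover have "(\<exists>Y. ?vec Y \<and> 2 * card (kernel_support G Y) \<le> n) \<longleftrightarrow>
      (\<exists>Y Z. ?vec Y \<and> ?vec Z \<and> kernel_support G Y \<inter> kernel_support G Z = {})"
  proof
    assume "\<exists>Y. ?vec Y \<and> 2 * card (kernel_support G Y) \<le> n"
    then obtain Y where Y: "Y \<subseteq> ?V" "Y \<noteq> {}" "2 * card (kernel_support G Y) \<le> card ?V"
      using assms(2) by blast
    obtain Z where "Z \<subseteq> ?V" "Z \<noteq> {}" "kernel_support G Z \<inter> kernel_support G Y = {}"
      using exists_disjoint_kernel_support[OF G Y] by metis
    then show "\<exists>Y Z. ?vec Y \<and> ?vec Z \<and> kernel_support G Y \<inter> kernel_support G Z = {}"
      using Y by blast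
  next
    assume "\<exists>Y Z. ?vec Y \<and> ?vec Z \<and> kernel_support G Y \<inter> kernel_support G Z = {}"
    then obtain Y Z where YZ: "?vec Y" "?vec Z" "kernel_support G Y \<inter> kernel_support G Z = {}"
      by blast
    have sub: "kernel_support G Y \<subseteq> ?V" "kernel_support G Z \<subseteq> ?V"
      using YZ kernel_support_subset by metis+
    \<comment> \<open>Two disjoint supports have total size at most \<open>n\<close>, so one of them
      has at most half of the vertices.\<close>
    then have "card (kernel_support G Y) + card (kernel_support G Z)
        = card (kernel_support G Y \<union> kernel_support G Z)"
      using YZ(3) fin finite_subset by (intro card_Un_disjoint[symmetric]) auto
    also have "\<dots> \<le> n" unfolding assms(2) using fin sub by (intro card_mono) auto
    finally have "2 * card (kernel_support G Y) \<le> n \<or> 2 * card (kernel_support G Z) \<le> n" by linarith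
    then show "\<exists>Y. ?vec Y \<and> 2 * card (kernel_support G Y) \<le> n" using YZ by blast
  qed
  moreover have "?D \<longleftrightarrow> (\<exists>Y Z. ?vec Y \<and> ?vec Z \<and> kernel_support G Y \<inter> kernel_support G Z = {})"
    unfolding assms(2,4) vertical_connectivity_ias_less_iff[OF G] by blast
  ultimately show ?thesis using B C by argo
qed

end
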